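(* Let $m\ge 2$, $n\ge 1$, and let $\mathcal{A}\in T_{m,n}$ be a P tensor (respectively, a P$_0$ tensor). Then every principal sub-tensor of $\mathcal{A}$ is a P tensor (respectively, a P$_0$ tensor). In particular, all diagonal entries $a_{ii\cdots i}$ of $\mathcal{A}$ are positive (respectively, nonnegative).
   Context: $I_n=\{1,\dots,n\}$. $T_{m,n}$ is the set of real $m$th order $n$-dimensional tensors $\mathcal{A}=(a_{i_1\cdots i_m})$, $i_1,\dots,i_m\in I_n$. For $\mathbf{x}\in\mathbb{R}^n$, $\mathcal{A}\mathbf{x}^{m-1}\in\mathbb{R}^n$ has $i$th component $(\mathcal{A}\mathbf{x}^{m-1})_i=\sum_{i_2,\dots,i_m=1}^n a_{ii_2\cdots i_m}x_{i_2}\cdots x_{i_m}$. $\mathcal{A}$ is a P$_0$ tensor if for every nonzero $\mathbf{x}\in\mathbb{R}^n$ there exists $i\in I_n$ with $x_i\ne 0$ and $x_i(\mathcal{A}\mathbf{x}^{m-1})_i\ge 0$. $\mathcal{A}$ is a P tensor if for every nonzero $\mathbf{x}\in\mathbb{R}^n$, $\max_{i\in I_n}x_i(\mathcal{A}\mathbf{x}^{m-1})_i>0$. For a subset $J\subset I_n$ with $|J|=r$, $1\le r\le n$, the principal sub-tensor $\mathcal{A}^J_r\in T_{m,r}$ of $\mathcal{A}$ is the tensor $(a_{i_1\cdots i_m})_{i_1,\dots,i_m\in J}$, with indices ranging over $J$; the P and P$_0$ properties of $\mathcal{A}^J_r$ are understood with index set $J$ in place of $I_n$ and vectors indexed by $J$.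 *)

theory Defs
  imports Complex_Main "HOL-Library.FuncSet"
begin

text \<open>
  Index sets are arbitrary finite sets \<open>J\<close> of naturals (\<open>I\<^sub>n = {1..n}\<close> for an ambient tensor, a nonempty
  subset of it for a principal sub-tensor). The multi-index \<open>(i\<^sub>1, \<dots>, i\<^sub>m)\<close> is the list
  \<open>[i\<^sub>1, \<dots>, i\<^sub>m]\<close>. Vectors and tensors are extensional functions: \<open>\<real>\<^sup>J\<close> is \<open>vectors J\<close>, and
  \<open>T\<close> with order \<open>m\<close> and index set \<open>J\<close> is \<open>tensors m J\<close>.
\<close>

definition multi_indices :: "nat \<Rightarrow> nat set \<Rightarrow> nat list set" where
  "multi_indices m J = {ks. length ks = m \<and> set ks \<subseteq> J}"

definition vectors :: "nat set \<Rightarrow> (nat \<Rightarrow> real) set" where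
  "vectors J = (J \<rightarrow>\<^sub>E UNIV)"

definition tensors :: "nat \<Rightarrow> nat set \<Rightarrow> (nat list \<Rightarrow> real) set" where
  "tensors m J = (multi_indices m J \<rightarrow>\<^sub>E UNIV)"

text \<open>The vector \<open>A x\<^sup>m\<^sup>-\<^sup>1\<close>; the list \<open>ks\<close> is \<open>[i\<^sub>2, \<dots>, i\<^sub>m]\<close>.\<close>

definition tensor_apply ::
    "nat \<Rightarrow> nat set \<Rightarrow> (nat list \<Rightarrow> real) \<Rightarrow> (nat \<Rightarrow> real) \<Rightarrow> nat \<Rightarrow> real" where
  "tensor_apply m J A x =
     (\<lambda>i\<in>J. \<Sum>ks\<in>multi_indices (m - 1) J. A (i # ks) * prod_list (map x ks))"

text \<open>The nonzero vectors are those with some nonzero coordinate in \<open>J\<close>; in particular \<open>J\<close> is nonempty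
  whenever the maximum below is taken.\<close>

definition P_tensor :: "nat \<Rightarrow> nat set \<Rightarrow> (nat list \<Rightarrow> real) \<Rightarrow> bool" where
  "P_tensor m J A \<longleftrightarrow>
     (\<forall>x\<in>vectors J. (\<exists>i\<in>J. x i \<noteq> 0) \<longrightarrow>
        Max ((\<lambda>i. x i * tensor_apply m J A x i) ` J) > 0)"

definition P0_tensor :: "nat \<Rightarrow> nat set \<Rightarrow> (nat list \<Rightarrow> real) \<Rightarrow> bool" where
  "P0_tensor m J A \<longleftrightarrow>
     (\<forall>x\<in>vectors J. (\<exists>i\<in>J. x i \<noteq> 0) \<longrightarrow>
        (\<exists>i\<in>J. x i \<noteq> 0 \<and> x i * tensor_apply m J A x i \<ge> 0))"

definition principal_subtensor ::
    "nat \<Rightarrow> nat set \<Rightarrow> (nat list \<Rightarrow> real) \<Rightarrow> nat list \<Rightarrow> real" where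
  "principal_subtensor m J A = restrict A (multi_indices m J)"

end

theory Submission imports Defs
begin

text \<open>
  Extending a vector \<open>x\<close> indexed by \<open>J\<close> by zeros to a vector \<open>y\<close> kills every monomial with an index
  outside \<open>J\<close>, so \<open>A y\<^sup>m\<^sup>-\<^sup>1\<close> agrees on \<open>J\<close> with the sub-tensor applied to \<open>x\<close>, while coordinates outside \<open>J\<close>
  contribute \<open>y\<^sub>i (A y\<^sup>m\<^sup>-\<^sup>1)\<^sub>i = 0\<close>. Diagonal entries are the principal sub-tensors on singletons,
  tested at the vector \<open>1\<close>.
\<close>

text \<open>The abstraction is restricted to \<open>I\<close> because \<open>vectors I\<close>
  contains only extensional functions: the value is 0 on \<open>I - J\<close>, but
  \<open>undefined\<close> outside \<open>I\<close>.\<close>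

definition zero_extension :: "nat set \<Rightarrow> nat set \<Rightarrow> (nat \<Rightarrow> real) \<Rightarrow> nat \<Rightarrow> real" where
  "zero_extension I J x = (\<lambda>i\<in>I. if i \<in> J then x i else 0)"

lemma zero_extension_in_vectors: "zero_extension I J x \<in> vectors I"
  by (simp add: zero_extension_def vectors_def)

lemma zero_extension_apply:
  assumes "J \<subseteq> I"
  shows "i \<in> J \<Longrightarrow> zero_extension I J x i = x i"
    and "i \<in> I - J \<Longrightarrow> zero_extension I J x i = 0"
  using assms by (auto simp: zero_extension_def)

lemma finite_multi_indices: "finite I \<Longrightarrow> finite (multi_indices m I)"
  unfolding multi_indices_def using finite_lists_length_eq[of I m] by (simp add: conj_commute)

lemma tensor_apply_zero_extension:
  assumes "finite I" "J \<subseteq> I" "m \<ge> 1" "i \<in> J"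
  shows "tensor_apply m I A (zero_extension I J x) i =
         tensor_apply m J (principal_subtensor m J A) x i"
proof -
  let ?y = "zero_extension I J x"
  have "(\<Sum>ks\<in>multi_indices (m - 1) I. A (i # ks) * prod_list (map ?y ks)) =
        (\<Sum>ks\<in>multi_indices (m - 1) J. A (i # ks) * prod_list (map ?y ks))"
  proof (rule sum.mono_neutral_right)
    show "finite (multi_indices (m - 1) I)"
      using assms(1) by (rule finite_multi_indices)
    show "multi_indices (m - 1) J \<subseteq> multi_indices (m - 1) I"
      using assms(2) by (auto simp: multi_indices_def)
    show "\<forall>ks\<in>multi_indices (m - 1) I - multi_indices (m - 1) J.
            A (i # ks) * prod_list (map ?y ks) = 0"
    proof
      fix ks assume "ks \<in> multi_indices (m - 1) I - multi_indices (m - 1) J"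
      then obtain k where "k \<in> set ks" "k \<in> I - J"
        by (auto simp: multi_indices_def)
      \<comment> \<open>A single index \<open>k\<close> outside \<open>J\<close> already puts a zero
        factor into the monomial.\<close>
      then have "0 \<in> set (map ?y ks)"
        using zero_extension_apply(2)[OF assms(2)] by force
      then show "A (i # ks) * prod_list (map ?y ks) = 0"
        by (simp add: prod_list_zero_iff)
    qed
  qed
  also have "\<dots> = (\<Sum>ks\<in>multi_indices (m - 1) J.
                    principal_subtensor m J A (i # ks) * prod_list (map x ks))"
  proof (rule sum.cong)
    fix ks assume ks: "ks \<in> multi_indices (m - 1) J"
    then have "map ?y ks = map x ks"
      using zero_extension_apply(1)[OF assms(2)] by (auto simp: multi_indices_def)
    \<comment> \<open>Both \<open>i\<close> and \<open>ks\<close> stay in \<open>J\<close>, so the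
      restriction keeps this entry. The bound on \<open>m\<close> makes the length
      \<open>m - 1 + 1\<close> equal to \<open>m\<close>; at \<open>m = 0\<close> truncated
      subtraction would give a list of length 1.\<close>
    moreover have "i # ks \<in> multi_indices m J"
      using ks assms(3,4) by (auto simp: multi_indices_def)
    ultimately show "A (i # ks) * prod_list (map ?y ks) =
                     principal_subtensor m J A (i # ks) * prod_list (map x ks)"
      by (simp only: principal_subtensor_def restrict_apply if_True)
  qed simp
  finally show ?thesis
    using assms(2,4) by (auto simp: tensor_apply_def)
qed

text \<open>A finite nonempty maximum is positive exactly when some element is, and a nonzero
  coordinate makes \<open>J\<close> nonempty. In this form a witness index can be carried from
  \<open>I\<close> to \<open>J\<close>.\<close>

lemma P_tensor_iff:
  assumes "finite J"
  shows "P_tensor m J A \<longleftrightarrow>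
         (\<forall>x\<in>vectors J. (\<exists>i\<in>J. x i \<noteq> 0) \<longrightarrow> (\<exists>i\<in>J. x i * tensor_apply m J A x i > 0))"
proof -
  have "Max (f ` J) > 0 \<longleftrightarrow> (\<exists>i\<in>J. f i > 0)" if "\<exists>i\<in>J. x i \<noteq> 0" for f x :: "nat \<Rightarrow> real"
    using assms that by (subst Max_gr_iff) auto
  \<comment> \<open>The congruence rules let the simplifier assume the nonzero coordinate while it
    rewrites the maximum.\<close>
  then show ?thesis
    unfolding P_tensor_def by (simp cong: ball_cong imp_cong)
qed

lemma P_tensor_principal_subtensor:
  assumes "finite I" "J \<subseteq> I" "m \<ge> 1" "P_tensor m I A"
  shows "P_tensor m J (principal_subtensor m J A)"
  unfolding P_tensor_iff[OF finite_subset[OF assms(2,1)]]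
proof (intro ballI impI)
  fix x :: "nat \<Rightarrow> real" assume "\<exists>i\<in>J. x i \<noteq> 0"
  let ?y = "zero_extension I J x"
  have "\<exists>i\<in>I. ?y i \<noteq> 0"
    using \<open>\<exists>i\<in>J. x i \<noteq> 0\<close> assms(2) by (auto simp: zero_extension_def)
  then obtain i where i: "i \<in> I" "?y i * tensor_apply m I A ?y i > 0"
    using assms(4)[unfolded P_tensor_iff[OF assms(1)]] zero_extension_in_vectors[of I J x] by meson
  \<comment> \<open>Outside \<open>J\<close> the product would be 0, against strict
    positivity.\<close>
  then have "i \<in> J"
    using zero_extension_apply(2)[OF assms(2), of i x] by (cases "i \<in> J") auto
  then show "\<exists>i\<in>J. x i * tensor_apply m J (principal_subtensor m J A) x i > 0"
    using i tensor_apply_zero_extension[OF assms(1-3) \<open>i \<in> J\<close>, of A x]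
      zero_extension_apply(1)[OF assms(2) \<open>i \<in> J\<close>, of x] by auto
qed

lemma P0_tensor_principal_subtensor:
  assumes "finite I" "J \<subseteq> I" "m \<ge> 1" "P0_tensor m I A"
  shows "P0_tensor m J (principal_subtensor m J A)"
  unfolding P0_tensor_def
proof (intro ballI impI)
  fix x :: "nat \<Rightarrow> real" assume "\<exists>i\<in>J. x i \<noteq> 0"
  let ?y = "zero_extension I J x"
  have "\<exists>i\<in>I. ?y i \<noteq> 0"
    using \<open>\<exists>i\<in>J. x i \<noteq> 0\<close> assms(2) by (auto simp: zero_extension_def)
  then obtain i where i: "i \<in> I" "?y i \<noteq> 0" "?y i * tensor_apply m I A ?y i \<ge> 0"
    using assms(4)[unfolded P0_tensor_def] zero_extension_in_vectors[of I J x] by meson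
  \<comment> \<open>A zero product would satisfy the weak inequality, so here it is
    \<open>?y i \<noteq> 0\<close> that forces the index into \<open>J\<close>.\<close>
  then have "i \<in> J"
    using zero_extension_apply(2)[OF assms(2), of i x] by (cases "i \<in> J") auto
  then show "\<exists>i\<in>J. x i \<noteq> 0 \<and>
      x i * tensor_apply m J (principal_subtensor m J A) x i \<ge> 0"
    using i tensor_apply_zero_extension[OF assms(1-3) \<open>i \<in> J\<close>, of A x]
      zero_extension_apply(1)[OF assms(2) \<open>i \<in> J\<close>, of x] by auto
qed

lemma multi_indices_singleton: "multi_indices k {i} = {replicate k i}"
  by (auto simp: multi_indices_def intro!: replicate_eqI)

text \<open>Over one index the sum has the single term \<open>replicate (m - 1) i\<close>, whose
  monomial at the vector 1 equals 1.\<close>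

lemma tensor_apply_singleton:
  assumes "m \<ge> 1"
  shows "tensor_apply m {i} (principal_subtensor m {i} A) (\<lambda>j\<in>{i}. 1) i = A (replicate m i)"
proof -
  have "i # replicate (m - 1) i = replicate m i"
    using assms by (cases m) auto
  then show ?thesis
    by (simp add: tensor_apply_def principal_subtensor_def multi_indices_singleton)
qed

lemma P_tensor_diagonal_pos:
  assumes "finite I" "m \<ge> 1" "P_tensor m I A" "i \<in> I"
  shows "A (replicate m i) > 0"
proof -
  have "P_tensor m {i} (principal_subtensor m {i} A)"
    using assms by (intro P_tensor_principal_subtensor[of I]) auto
  moreover have "(\<lambda>j\<in>{i}. 1) \<in> vectors {i}" (is "?e \<in> _")
    by (simp add: vectors_def)
  \<comment> \<open>The only possible witness is \<open>i\<close> itself, and its product is 1 times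
    the diagonal entry.\<close>
  ultimately show ?thesis
    unfolding P_tensor_iff[OF finite.insertI[OF finite.emptyI]]
    using tensor_apply_singleton[OF assms(2), of i A] by (auto dest!: bspec[where x = ?e])
qed

lemma P0_tensor_diagonal_nonneg:
  assumes "finite I" "m \<ge> 1" "P0_tensor m I A" "i \<in> I"
  shows "A (replicate m i) \<ge> 0"
proof -
  have "P0_tensor m {i} (principal_subtensor m {i} A)"
    using assms by (intro P0_tensor_principal_subtensor[of I]) auto
  moreover have "(\<lambda>j\<in>{i}. 1) \<in> vectors {i}" (is "?e \<in> _")
    by (simp add: vectors_def)
  ultimately show ?thesis
    unfolding P0_tensor_def
    using tensor_apply_singleton[OF assms(2), of i A] by (auto dest!: bspec[where x = ?e])
qed

theorem theorem4p1:
  fixes m n :: nat and A :: "nat list \<Rightarrow> real"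
  assumes "m \<ge> 2" and "n \<ge> 1" and "A \<in> tensors m {1..n}"
  shows "(P_tensor m {1..n} A \<longrightarrow>
            (\<forall>J. J \<subseteq> {1..n} \<and> J \<noteq> {} \<longrightarrow> P_tensor m J (principal_subtensor m J A)) \<and>
            (\<forall>i\<in>{1..n}. A (replicate m i) > 0)) \<and>
         (P0_tensor m {1..n} A \<longrightarrow>
            (\<forall>J. J \<subseteq> {1..n} \<and> J \<noteq> {} \<longrightarrow> P0_tensor m J (principal_subtensor m J A)) \<and>
            (\<forall>i\<in>{1..n}. A (replicate m i) \<ge> 0))"
proof -
  have "m \<ge> 1"
    using assms(1) by simp
  have fin: "finite {1..n}"
    by simp
  show ?thesis
    using P_tensor_principal_subtensor[OF fin _ \<open>m \<ge> 1\<close>, of _ A]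
      P0_tensor_principal_subtensor[OF fin _ \<open>m \<ge> 1\<close>, of _ A]
      P_tensor_diagonal_pos[OF fin \<open>m \<ge> 1\<close>, of A]
      P0_tensor_diagonal_nonneg[OF fin \<open>m \<ge> 1\<close>, of A]
    by simp
qed

end
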